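(* For any prime power $q\equiv 3\pmod 4$, the hypergraph $\mathcal{H}_q$ has exactly $\frac{q+1}{16}\binom{q+1}{3}$ hyperedges, and every set of $3$ vertices of $\mathcal{H}_q$ is contained in exactly $\frac{q+1}{4}$ hyperedges.
   Context: $\mathbb{P}^1\mathbb{F}_q$ is the projective line over $\mathbb{F}_q$, i.e. the set of classes $[u_1:u_2]$ of nonzero vectors of $\mathbb{F}_q^2$ modulo nonzero scalars. For $u=(u_1,u_2),v=(v_1,v_2)\in\mathbb{F}_q^2$ let $D(u,v)=u_1v_2-u_2v_1$. Let $\chi$ be the quadratic character of $\mathbb{F}_q$ ($\chi(0)=0$, $\chi(x)=1$ for nonzero squares, $\chi(x)=-1$ otherwise). Define $S(a,b,c,d)=\chi\big(D(a,b)D(b,c)D(c,d)D(a,d)\big)$, which is well defined on $(\mathbb{P}^1\mathbb{F}_q)^4$. The hypergraph $\mathcal{H}_q$ has vertex set $\mathbb{P}^1\mathbb{F}_q$, and a set $\{a,b,c,d\}$ of four distinct points is a hyperedge iff $S(\pi(a),\pi(b),\pi(c),\pi(d))=-1$ for every permutation $\pi$ of $\{a,b,c,d\}$.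
   Formalization: The last factor D(a,d) in S is replaced by D(d,a); with D(a,d), S(a,b,c,d)S(a,c,b,d)S(a,b,d,c)=1 for distinct points, so S is never -1 on all orderings and the hypergraph has no hyperedges, contradicting the claimed count (1 for q=3). *)

theory Defs
  imports Complex_Main "HOL-Number_Theory.Prime_Powers" "HOL-Combinatorics.Permutations"
begin

definition proj_rel :: "'a::field \<times> 'a \<Rightarrow> 'a \<times> 'a \<Rightarrow> bool" where
  "proj_rel u v \<longleftrightarrow>
     u \<noteq> (0, 0) \<and> v \<noteq> (0, 0) \<and> (\<exists>c. c \<noteq> 0 \<and> v = (c * fst u, c * snd u))"

lemma proj_rel_part_equivp: "part_equivp (proj_rel :: 'a::field \<times> 'a \<Rightarrow> _)"
proof (rule part_equivpI)
  show "\<exists>u :: 'a \<times> 'a. proj_rel u u"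
    by (rule exI[of _ "(1, 1)"]) (auto simp: proj_rel_def intro: exI[of _ 1])
  show "symp (proj_rel :: 'a \<times> 'a \<Rightarrow> _)"
  proof (rule sympI)
    fix u v :: "'a \<times> 'a"
    assume "proj_rel u v"
    then obtain c where c: "c \<noteq> 0" "v = (c * fst u, c * snd u)" "u \<noteq> (0, 0)" "v \<noteq> (0, 0)"
      unfolding proj_rel_def by blast
    then have "u = (inverse c * fst v, inverse c * snd v)"
      by (simp add: prod_eq_iff)
    with c show "proj_rel v u"
      unfolding proj_rel_def by (metis inverse_nonzero_iff_nonzero)
  qed
  show "transp (proj_rel :: 'a \<times> 'a \<Rightarrow> _)"
  proof (rule transpI)
    fix u v w :: "'a \<times> 'a"
    assume "proj_rel u v" "proj_rel v w"
    then obtain c d where "c \<noteq> 0" "v = (c * fst u, c * snd u)" "u \<noteq> (0, 0)"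
      "d \<noteq> 0" "w = (d * fst v, d * snd v)" "w \<noteq> (0, 0)"
      unfolding proj_rel_def by blast
    then show "proj_rel u w"
      unfolding proj_rel_def by (intro conjI exI[of _ "d * c"]) (auto simp: mult.assoc)
  qed
qed

text \<open>The relation is partial: it relates only nonzero vectors, so the type
  \<open>'a proj_line\<close> consists exactly of the classes of nonzero vectors.\<close>

quotient_type (overloaded) 'a proj_line = "'a::field \<times> 'a" / partial: proj_rel
  by (rule proj_rel_part_equivp)

definition vdet :: "'a::field \<times> 'a \<Rightarrow> 'a \<times> 'a \<Rightarrow> 'a" where
  "vdet u v = fst u * snd v - snd u * fst v"

definition quad_char :: "'a::field \<Rightarrow> int" where
  "quad_char x = (if x = 0 then 0 else if \<exists>y. x = y\<^sup>2 then 1 else - 1)"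

lemma quad_char_mult_square:
  assumes "k \<noteq> 0"
  shows "quad_char (k\<^sup>2 * x) = quad_char x"
proof -
  have "(\<exists>y. k\<^sup>2 * x = y\<^sup>2) \<longleftrightarrow> (\<exists>y. x = y\<^sup>2)"
  proof
    assume "\<exists>y. k\<^sup>2 * x = y\<^sup>2"
    then obtain y where "k\<^sup>2 * x = y\<^sup>2" ..
    then have "x = (y / k)\<^sup>2"
      using assms by (simp add: field_simps)
    then show "\<exists>y. x = y\<^sup>2" ..
  next
    assume "\<exists>y. x = y\<^sup>2"
    then obtain y where "x = y\<^sup>2" ..
    then have "k\<^sup>2 * x = (k * y)\<^sup>2"
      by (simp add: power_mult_distrib)
    then show "\<exists>y. k\<^sup>2 * x = y\<^sup>2" ..
  qed
  then show ?thesis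
    using assms by (simp add: quad_char_def)
qed

text \<open>The symbol \<open>S(a, b, c, d)\<close>; the proof shows that it does not depend on the representatives.
  The last factor is the cyclic \<open>D(d, a)\<close>, not \<open>D(a, d)\<close>. With \<open>D(a, d)\<close> the identity
  \<open>S(a, b, c, d) S(a, c, b, d) S(a, b, d, c) = 1\<close> would hold for distinct points, so \<open>S\<close> could
  never be \<open>-1\<close> on all orderings and the hypergraph below would have no hyperedges. If \<open>-1\<close>
  is not a square, the two versions of \<open>S\<close> differ exactly by the sign.\<close>

lift_definition sign4 ::
  "'a::field proj_line \<Rightarrow> 'a proj_line \<Rightarrow> 'a proj_line \<Rightarrow> 'a proj_line \<Rightarrow> int"
  is "\<lambda>a b c d. quad_char (vdet a b * vdet b c * vdet c d * vdet d a)"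
proof -
  fix a a' b b' c c' d d' :: "'a \<times> 'a"
  assume rel: "proj_rel a a'" "proj_rel b b'" "proj_rel c c'" "proj_rel d d'"
  obtain ka where ka: "ka \<noteq> 0" "a' = (ka * fst a, ka * snd a)"
    using rel(1) unfolding proj_rel_def by blast
  obtain kb where kb: "kb \<noteq> 0" "b' = (kb * fst b, kb * snd b)"
    using rel(2) unfolding proj_rel_def by blast
  obtain kc where kc: "kc \<noteq> 0" "c' = (kc * fst c, kc * snd c)"
    using rel(3) unfolding proj_rel_def by blast
  obtain kd where kd: "kd \<noteq> 0" "d' = (kd * fst d, kd * snd d)"
    using rel(4) unfolding proj_rel_def by blast
  have "vdet a' b' = ka * kb * vdet a b" "vdet b' c' = kb * kc * vdet b c"
    "vdet c' d' = kc * kd * vdet c d" "vdet d' a' = kd * ka * vdet d a"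
    by (simp_all add: ka kb kc kd vdet_def algebra_simps)
  then have "vdet a' b' * vdet b' c' * vdet c' d' * vdet d' a' =
      (ka * kb * kc * kd)\<^sup>2 * (vdet a b * vdet b c * vdet c d * vdet d a)"
    by (simp only: power2_eq_square mult_ac)
  moreover have "ka * kb * kc * kd \<noteq> 0"
    using ka(1) kb(1) kc(1) kd(1) by simp
  ultimately show "quad_char (vdet a b * vdet b c * vdet c d * vdet d a) =
      quad_char (vdet a' b' * vdet b' c' * vdet c' d' * vdet d' a')"
    by (simp only: quad_char_mult_square not_False_eq_True)
qed

text \<open>The hypergraph \<open>H\<^sub>q\<close>, as the pair of its vertex set and its set of hyperedges.\<close>

definition hypergraph_H :: "'a::field itself \<Rightarrow> 'a proj_line set \<times> 'a proj_line set set" where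
  "hypergraph_H _ =
    (UNIV,
     {e. \<exists>a b c d. e = {a, b, c, d} \<and> distinct [a, b, c, d] \<and>
           (\<forall>\<pi>. \<pi> permutes {a, b, c, d} \<longrightarrow> sign4 (\<pi> a) (\<pi> b) (\<pi> c) (\<pi> d) = - 1)})"

abbreviation verts :: "'v set \<times> 'v set set \<Rightarrow> 'v set" where
  "verts \<equiv> fst"

abbreviation hyperedges :: "'v set \<times> 'v set set \<Rightarrow> 'v set set" where
  "hyperedges \<equiv> snd"

end

theory Submission
  imports Defs "HOL-Number_Theory.Residues"
begin

text \<open>Fix three distinct points \<open>a\<close>, \<open>b\<close>, \<open>c\<close>. The points other than \<open>a\<close> are
  parametrised by \<open>t\<close> in the field so that the Pluecker relation
  \<open>D(b,c) D(a,d) + D(c,a) D(b,d) + D(a,b) D(c,d) = 0\<close> reads \<open>K + t K - (1 + t) K = 0\<close> with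
  \<open>K \<noteq> 0\<close>. Then all orderings of \<open>a\<close>, \<open>b\<close>, \<open>c\<close>, \<open>d\<close> have sign \<open>-1\<close> iff \<open>t\<close> is a nonzero square
  and \<open>1 + t\<close> is a nonsquare. The substitutions \<open>t \<mapsto> -1 - t\<close> and \<open>t \<mapsto> 1 / t\<close> show that the three
  other sign patterns of \<open>(t, 1 + t)\<close> are equally frequent, which leaves \<open>(q + 1) / 4\<close> values
  of \<open>t\<close>. The number of hyperedges follows by counting incident pairs of a triple and a hyperedge.\<close>

section \<open>Squares in a finite field and the quadratic character\<close>

lemma finite_field_power_card_minus_1:
  fixes x :: "'a::{field, finite}"
  assumes "x \<noteq> 0"
  shows "x ^ (card (UNIV :: 'a set) - 1) = 1"
proof -
  let ?U = "UNIV - {0 :: 'a}"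
  \<comment> \<open>Multiplication by \<open>x\<close> permutes the nonzero elements, so their
    product is unchanged.\<close>
  have "prod id ?U = (\<Prod>y\<in>?U. x * y)"
    by (rule prod.reindex_bij_witness[of _ "\<lambda>y. x * y" "\<lambda>y. y / x"]) (use assms in auto)
  also have "\<dots> = x ^ card ?U * prod id ?U"
    by (simp add: prod.distrib)
  finally have "x ^ card ?U = 1"
    by simp
  then show ?thesis
    by (simp add: card_Diff_singleton)
qed

text \<open>Otherwise the characteristic would be 2, and it divides the order of the field.\<close>

lemma one_neq_minus_one_if_odd_card:
  assumes "odd (card (UNIV :: 'a::{field, finite} set))"
  shows "(1 :: 'a) \<noteq> - 1"
proof
  assume "(1 :: 'a) = - 1"
  then have "of_nat 2 = (0 :: 'a)"
    by (metis add.right_inverse of_nat_numeral one_add_one)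
  then have "CHAR('a) dvd 2"
    by (simp only: of_nat_eq_0_iff_char_dvd)
  then have "CHAR('a) = 2"
    using CHAR_not_1'[where 'a = 'a] two_is_prime_nat unfolding prime_nat_iff One_nat_def by blast
  then show False
    using CHAR_dvd_CARD[where 'a = 'a] assms by simp
qed

lemma quad_char_eq_1_iff: "quad_char x = 1 \<longleftrightarrow> x \<noteq> 0 \<and> (\<exists>y. x = y\<^sup>2)"
  by (auto simp: quad_char_def)

text \<open>For a field of order \<open>q\<close>, a square root of -1 raised to the power
  \<open>q - 1\<close> is -1 to the odd exponent \<open>(q - 1) / 2\<close>, yet this power must be
  1.\<close>

lemma neg_one_not_square:
  assumes "card (UNIV :: 'a::{field, finite} set) mod 4 = 3"
  shows "(y :: 'a)\<^sup>2 \<noteq> - 1"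
proof
  assume y: "y\<^sup>2 = - 1"
  have odd: "odd (card (UNIV :: 'a set))"
    using assms by presburger
  define k where "k = card (UNIV :: 'a set) div 4"
  have k: "card (UNIV :: 'a set) - 1 = 2 * (2 * k + 1)"
    using assms unfolding k_def by presburger
  have "y \<noteq> 0"
    using y by auto
  then have "y ^ (2 * (2 * k + 1)) = 1"
    using finite_field_power_card_minus_1[of y] by (simp only: k not_False_eq_True)
  then have "(- 1 :: 'a) = 1"
    unfolding power_mult y by simp
  then show False
    using one_neq_minus_one_if_odd_card[where 'a = 'a] odd by simp
qed

text \<open>Squaring is two-to-one on the nonzero elements; the pairs \<open>(y, y\<^sup>2)\<close>
  are counted in two ways.\<close>

lemma card_nonzero_squares:
  assumes "odd (card (UNIV :: 'a::{field, finite} set))"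
  shows "2 * card {x :: 'a. quad_char x = 1} = card (UNIV :: 'a set) - 1"
proof -
  let ?R = "{x :: 'a. quad_char x = 1}"
  let ?U = "UNIV - {0 :: 'a}"
  have fibre: "card {y \<in> ?U. y\<^sup>2 = x} = 2" if x: "x \<in> ?R" for x
  proof -
    obtain z where z: "x = z\<^sup>2"
      using x unfolding mem_Collect_eq quad_char_eq_1_iff by blast
    have "z \<noteq> 0"
      using x z by (auto simp: quad_char_eq_1_iff)
    have "{y \<in> ?U. y\<^sup>2 = x} = {z, - z}"
      using z \<open>z \<noteq> 0\<close> by (auto simp: power2_eq_iff)
    moreover have "z \<noteq> - z"
      using one_neq_minus_one_if_odd_card[OF assms] \<open>z \<noteq> 0\<close>
      by (metis mult_cancel_right mult_minus1 mult_1)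
    ultimately show ?thesis
      by simp
  qed
  have "(\<Sum>y\<in>?U. card {x \<in> ?R. y\<^sup>2 = x}) = 2 * card ?R"
    by (rule sum_multicount) (use fibre in auto)
  moreover have "{x \<in> ?R. y\<^sup>2 = x} = {y\<^sup>2}" if "y \<in> ?U" for y
    using that by (auto simp: quad_char_def)
  ultimately show ?thesis
    by (simp add: card_Diff_singleton)
qed

text \<open>The nonzero squares and their negatives are disjoint because -1 is not a square, and
  each set is half of the nonzero elements, so negation exchanges squares and nonsquares.\<close>

lemma quad_char_minus:
  fixes x :: "'a::{field, finite}"
  assumes "card (UNIV :: 'a set) mod 4 = 3"
  shows "quad_char (- x) = - quad_char x"
proof -
  let ?R = "{x :: 'a. quad_char x = 1}"
  have odd: "odd (card (UNIV :: 'a set))"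
    using assms by presburger
  have R: "z \<in> ?R \<longleftrightarrow> z \<noteq> 0 \<and> (\<exists>y. z = y\<^sup>2)" for z
    by (simp add: quad_char_eq_1_iff)
  have disj: "?R \<inter> uminus ` ?R = {}"
  proof (rule ccontr)
    assume "?R \<inter> uminus ` ?R \<noteq> {}"
    then obtain u v :: 'a where "u\<^sup>2 = - (v\<^sup>2)" "v \<noteq> 0"
      using R by fastforce
    then have "(u / v)\<^sup>2 = - 1"
      by (simp add: power_divide)
    with neg_one_not_square[OF assms] show False
      by blast
  qed
  have "card (?R \<union> uminus ` ?R) = card ?R + card (uminus ` ?R)"
    using disj by (intro card_Un_disjoint) auto
  also have "\<dots> = card (UNIV - {0 :: 'a})"
    using card_nonzero_squares[OF odd] by (simp add: card_image card_Diff_singleton)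
  finally have "?R \<union> uminus ` ?R = UNIV - {0}"
    by (intro card_subset_eq) (auto simp: quad_char_def)
  then have "x \<noteq> 0 \<Longrightarrow> x \<in> ?R \<or> - x \<in> ?R"
    by force
  moreover have "\<not> (x \<in> ?R \<and> - x \<in> ?R)"
    using disj by force
  ultimately show ?thesis
    unfolding R by (auto simp: quad_char_def)
qed

text \<open>Every nonzero \<open>x\<close> is a square or the negative of one, so multiplication by
  squares and the sign rule suffice.\<close>

lemma quad_char_mult:
  fixes x y :: "'a::{field, finite}"
  assumes "card (UNIV :: 'a set) mod 4 = 3"
  shows "quad_char (x * y) = quad_char x * quad_char y"
proof -
  have square: "quad_char (s * y) = quad_char s * quad_char y" if s: "quad_char s = 1" for s y :: 'a
  proof -
    obtain k where k: "s = k\<^sup>2"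
      using s unfolding quad_char_eq_1_iff by blast
    moreover have "k \<noteq> 0"
      using s k by (auto simp: quad_char_eq_1_iff)
    ultimately show ?thesis
      using that by (simp add: quad_char_mult_square)
  qed
  consider "x = 0" | "quad_char x = 1" | "quad_char (- x) = 1"
    unfolding quad_char_minus[OF assms] by (cases "x = 0"; cases "\<exists>y. x = y\<^sup>2") (simp_all add: quad_char_def)
  then show ?thesis
  proof cases
    case 3
    then show ?thesis
      using square[of "- x" y] by (simp add: quad_char_minus[OF assms])
  qed (auto simp: square quad_char_def[of 0])
qed

text \<open>Let \<open>M\<close> be the wanted number, \<open>N\<close> the common size of the other
  three patterns and \<open>R\<close> the number of nonzero squares. Sorting the squares
  \<open>t\<close> by the sign of \<open>1 + t\<close>, and the squares \<open>1 + t\<close> by the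
  sign of \<open>t\<close>, gives \<open>R = N + M\<close> and \<open>R - 1 = 2 * N\<close>. With
  \<open>2 * R = q - 1\<close> this forces \<open>M = (q + 1) / 4\<close>.\<close>

lemma card_square_succ_nonsquare:
  assumes "card (UNIV :: 'a::{field, finite} set) mod 4 = 3"
  shows "4 * card {t :: 'a. quad_char t = 1 \<and> quad_char (1 + t) = - 1} = card (UNIV :: 'a set) + 1"
proof -
  let ?C = "\<lambda>i j. {t :: 'a. quad_char t = i \<and> quad_char (1 + t) = j}"
  let ?R = "{x :: 'a. quad_char x = 1}"
  note qm = quad_char_minus[OF assms] and qx = quad_char_mult[OF assms]
  have q0: "quad_char x = 0 \<longleftrightarrow> x = 0" for x :: 'a
    by (simp add: quad_char_def)
  have q1: "quad_char (1 :: 'a) = 1"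
    unfolding quad_char_eq_1_iff by (auto intro: exI[of _ 1])
  have qinv: "quad_char (1 / x) = quad_char x" for x :: 'a
  proof (cases "x = 0")
    case False
    then have "quad_char (x\<^sup>2 * (1 / x)) = quad_char (1 / x)"
      by (intro quad_char_mult_square)
    with False show ?thesis
      by (simp add: power2_eq_square)
  qed simp
  have vals: "quad_char x = 0 \<or> quad_char x = 1 \<or> quad_char x = - 1" for x :: 'a
    by (auto simp: quad_char_def)
  \<comment> \<open>The substitution turns the pair \<open>(t, 1 + t)\<close> into
    \<open>(- (1 + t), - t)\<close>: the two signs are swapped and both are flipped.\<close>
  have "card (?C 1 1) = card (?C (- 1) (- 1))"
  proof (rule bij_betw_same_card[OF bij_betw_byWitness[where f = "\<lambda>t. - 1 - t" and f' = "\<lambda>t. - 1 - t"]])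
    have "quad_char (- 1 - t) = - quad_char (1 + t)" for t :: 'a
      using qm[of "1 + t"] by simp
    then show "(\<lambda>t. - 1 - t) ` ?C 1 1 \<subseteq> ?C (- 1) (- 1)" "(\<lambda>t. - 1 - t) ` ?C (- 1) (- 1) \<subseteq> ?C 1 1"
      by (auto simp: qm)
  qed auto
  also have "\<dots> = card (?C (- 1) 1)"
  proof (rule bij_betw_same_card[OF bij_betw_byWitness[where f = "\<lambda>t. 1 / t" and f' = "\<lambda>t. 1 / t"]])
    \<comment> \<open>Inverting a nonsquare \<open>t\<close> keeps its sign and flips the sign of
      \<open>1 + t\<close>.\<close>
    have "quad_char (1 + 1 / t) = quad_char (1 + t) * quad_char t" if "quad_char t = - 1" for t :: 'a
    proof -
      have "t \<noteq> 0"
        using that q0[of t] by auto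
      then have "1 + 1 / t = (1 + t) * (1 / t)"
        by (simp add: field_simps)
      then show ?thesis
        by (simp only: qx qinv)
    qed
    then show "(\<lambda>t. 1 / t) ` ?C (- 1) (- 1) \<subseteq> ?C (- 1) 1" "(\<lambda>t. 1 / t) ` ?C (- 1) 1 \<subseteq> ?C (- 1) (- 1)"
      by (auto simp: qinv)
  qed auto
  finally have eq: "card (?C 1 1) = card (?C (- 1) 1)" .
  have "?R = ?C 1 1 \<union> ?C 1 (- 1)"
  proof -
    have "quad_char (1 + t) = 1 \<or> quad_char (1 + t) = - 1" if "quad_char t = 1" for t :: 'a
    proof -
      \<comment> \<open>A zero here would make \<open>t = - 1\<close> a square.\<close>
      have "quad_char (1 + t) \<noteq> 0"
        using that qm[of 1] q1 by (auto simp: q0 add_eq_0_iff)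
      then show ?thesis
        using vals[of "1 + t"] by blast
    qed
    then show ?thesis
      by auto
  qed
  moreover have "card (?C 1 1 \<union> ?C 1 (- 1)) = card (?C 1 1) + card (?C 1 (- 1))"
    by (rule card_Un_disjoint) auto
  ultimately have R1: "card ?R = card (?C 1 1) + card (?C 1 (- 1))"
    by simp
  \<comment> \<open>Here \<open>x = 1 + t\<close> runs over the nonzero squares;
    \<open>x = 1\<close> is left out because \<open>t = 0\<close> has sign 0.\<close>
  have "?C 1 1 \<union> ?C (- 1) 1 = (\<lambda>x. x - 1) ` (?R - {1})"
  proof (intro equalityI subsetI)
    fix t assume "t \<in> ?C 1 1 \<union> ?C (- 1) 1"
    then show "t \<in> (\<lambda>x. x - 1) ` (?R - {1})"
      using q0[of 0] by (intro image_eqI[of _ _ "1 + t"]) auto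
  next
    fix t assume "t \<in> (\<lambda>x. x - 1) ` (?R - {1})"
    then show "t \<in> ?C 1 1 \<union> ?C (- 1) 1"
      using vals[of t] by (auto simp: q0)
  qed
  moreover have "card (?C 1 1 \<union> ?C (- 1) 1) = card (?C 1 1) + card (?C (- 1) 1)"
    by (rule card_Un_disjoint) auto
  moreover have "card ((\<lambda>x. x - 1) ` (?R - {1})) = card ?R - 1"
    using q1 by (simp add: card_image inj_on_def)
  ultimately have R2: "card (?C 1 1) + card (?C (- 1) 1) = card ?R - 1"
    by simp
  \<comment> \<open>Positivity keeps the truncated subtraction in \<open>R2\<close> exact.\<close>
  have "card ?R > 0"
    using q1 by (auto simp: card_gt_0_iff)
  moreover have "2 * card ?R = card (UNIV :: 'a set) - 1"
    by (rule card_nonzero_squares) (use assms in presburger)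
  ultimately show ?thesis
    using eq R1 R2 assms by linarith
qed

section \<open>Points, representatives and determinants\<close>

lemma proj_line_rep:
  obtains u where "u \<noteq> (0, 0)" "a = abs_proj_line u"
proof -
  have "proj_rel (rep_proj_line a) (rep_proj_line a)"
    by (rule Quotient3_rep_reflp[OF Quotient3_proj_line])
  moreover have "abs_proj_line (rep_proj_line a) = a"
    by (rule Quotient3_abs_rep[OF Quotient3_proj_line])
  ultimately show ?thesis
    using that unfolding proj_rel_def by metis
qed

lemma proj_rel_refl: "u \<noteq> (0, 0) \<Longrightarrow> proj_rel u u"
  unfolding proj_rel_def by (auto intro: exI[of _ 1])

lemma proj_rel_iff_vdet:
  assumes "u \<noteq> (0, 0)" "v \<noteq> (0, 0)"
  shows "proj_rel u v \<longleftrightarrow> vdet u v = 0"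
proof
  assume "proj_rel u v"
  then show "vdet u v = 0"
    by (auto simp: proj_rel_def vdet_def)
next
  assume det: "vdet u v = 0"
  show "proj_rel u v"
  \<comment> \<open>The scalar is a ratio of coordinates, taken where \<open>u\<close> has a nonzero
    coordinate.\<close>
  proof (cases "fst u = 0")
    case True
    with assms det have "snd u \<noteq> 0" "fst v = 0" "snd v \<noteq> 0"
      by (auto simp: vdet_def prod_eq_iff)
    with True assms show ?thesis
      unfolding proj_rel_def by (intro conjI exI[of _ "snd v / snd u"]) (auto simp: prod_eq_iff)
  next
    case False
    then have v: "v = (fst v / fst u * fst u, fst v / fst u * snd u)"
      using det by (simp add: vdet_def prod_eq_iff field_simps)
    with assms(2) have "fst v / fst u \<noteq> 0"
      by (metis mult_zero_left)
    with v assms show ?thesis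
      unfolding proj_rel_def by blast
  qed
qed

text \<open>Turns distinctness of points into nonvanishing determinants.\<close>

lemma abs_proj_line_eq_iff:
  assumes "u \<noteq> (0, 0)" "v \<noteq> (0, 0)"
  shows "abs_proj_line u = abs_proj_line v \<longleftrightarrow> vdet u v = 0"
  using Quotient3_rel[OF Quotient3_proj_line, of u v] assms
  by (simp add: proj_rel_refl proj_rel_iff_vdet)

lemma sign4_abs:
  assumes "a \<noteq> (0, 0)" "b \<noteq> (0, 0)" "c \<noteq> (0, 0)" "d \<noteq> (0, 0)"
  shows "sign4 (abs_proj_line a) (abs_proj_line b) (abs_proj_line c) (abs_proj_line d)
    = quad_char (vdet a b * vdet b c * vdet c d * vdet d a)"
  using assms by (simp add: sign4.abs_eq proj_rel_refl)

section \<open>Symmetries of the sign symbol and the hyperedge criterion\<close>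

lemma vdet_swap: "vdet v u = - vdet u v"
  by (simp add: vdet_def)

lemma sign4_rotate: "sign4 a b c d = sign4 b c d a"
  by transfer (simp add: mult_ac)

text \<open>Reversal negates all four determinants, and the four signs cancel.\<close>

lemma sign4_reverse: "sign4 a b c d = sign4 d c b a"
proof transfer
  fix a b c d :: "'a \<times> 'a"
  have "vdet a b * vdet b c * vdet c d * vdet d a = vdet d c * vdet c b * vdet b a * vdet a d"
    by (simp add: vdet_def algebra_simps)
  then show "quad_char (vdet a b * vdet b c * vdet c d * vdet d a)
      = quad_char (vdet d c * vdet c b * vdet b a * vdet a d)"
    by simp
qed

text \<open>One ordering for each cyclic arrangement of four points up to rotation and reversal,
  which replaces the quantifier over permutations.\<close>

definition all_orders_neg ::
  "'a::field proj_line \<Rightarrow> 'a proj_line \<Rightarrow> 'a proj_line \<Rightarrow> 'a proj_line \<Rightarrow> bool" where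
  "all_orders_neg a b c d \<longleftrightarrow> sign4 a b c d = - 1 \<and> sign4 a c b d = - 1 \<and> sign4 a b d c = - 1"

text \<open>By dihedral symmetry the 24 orderings of four points fall into three classes of eight.\<close>

lemma all_orders_neg_sign4:
  assumes neg: "all_orders_neg a b c d"
    and "distinct [a', b', c', d']" "{a', b', c', d'} \<subseteq> {a, b, c, d}"
  shows "sign4 a' b' c' d' = - 1"
proof -
  have *: "sign4 w x y z = - 1 \<and> sign4 x y z w = - 1 \<and> sign4 y z w x = - 1 \<and> sign4 z w x y = - 1 \<and>
      sign4 z y x w = - 1 \<and> sign4 y x w z = - 1 \<and> sign4 x w z y = - 1 \<and> sign4 w z y x = - 1"
    if "sign4 w x y z = - 1" for w x y z :: "'a proj_line"
    using that sign4_rotate[of w x y z] sign4_rotate[of x y z w] sign4_rotate[of y z w x]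
      sign4_reverse[of w x y z] sign4_reverse[of x y z w] sign4_reverse[of y z w x] sign4_reverse[of z w x y]
    by simp
  note n = neg[unfolded all_orders_neg_def]
  show ?thesis
    using assms(2,3) *[OF n[THEN conjunct1]] *[OF n[THEN conjunct2, THEN conjunct1]]
      *[OF n[THEN conjunct2, THEN conjunct2]]
    by auto
qed

text \<open>Membership supplies only some enumeration of the edge; its three signs control every
  other enumeration.\<close>

lemma hyperedge_insert_iff:
  fixes a b c d :: "'a::field proj_line"
  assumes "distinct [a, b, c, d]"
  shows "{a, b, c, d} \<in> hyperedges (hypergraph_H TYPE('a)) \<longleftrightarrow> all_orders_neg a b c d"
proof
  assume "{a, b, c, d} \<in> hyperedges (hypergraph_H TYPE('a))"
  then obtain a' b' c' d' where e: "{a, b, c, d} = {a', b', c', d'}" "distinct [a', b', c', d']"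
    and s: "\<And>\<pi>. \<pi> permutes {a', b', c', d'} \<Longrightarrow> sign4 (\<pi> a') (\<pi> b') (\<pi> c') (\<pi> d') = - 1"
    unfolding hypergraph_H_def by auto
  \<comment> \<open>The identity and the transpositions of the middle and of the last two points
    reach all three dihedral classes.\<close>
  have "sign4 a' b' c' d' = - 1"
    using s[of id] by (simp add: permutes_id)
  moreover have "sign4 a' c' b' d' = - 1"
    using s[OF permutes_swap_id[of b' _ c']] e(2) by (auto simp: transpose_def split: if_splits)
  moreover have "sign4 a' b' d' c' = - 1"
    using s[OF permutes_swap_id[of c' _ d']] e(2) by (auto simp: transpose_def split: if_splits)
  ultimately have neg: "all_orders_neg a' b' c' d'"
    unfolding all_orders_neg_def by simp
  show "all_orders_neg a b c d"
    unfolding all_orders_neg_def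
    by (intro conjI all_orders_neg_sign4[OF neg]) (use assms e(1) in auto)
next
  assume neg: "all_orders_neg a b c d"
  have "sign4 (\<pi> a) (\<pi> b) (\<pi> c) (\<pi> d) = - 1" if \<pi>: "\<pi> permutes {a, b, c, d}" for \<pi>
  proof (rule all_orders_neg_sign4[OF neg])
    show "distinct [\<pi> a, \<pi> b, \<pi> c, \<pi> d]"
      using assms permutes_inj[OF \<pi>] by (auto dest: injD)
    show "{\<pi> a, \<pi> b, \<pi> c, \<pi> d} \<subseteq> {a, b, c, d}"
      using permutes_image[OF \<pi>] by auto
  qed
  with assms show "{a, b, c, d} \<in> hyperedges (hypergraph_H TYPE('a))"
    unfolding hypergraph_H_def by auto
qed

section \<open>Parametrising the points other than a given one\<close>

text \<open>A representative of the point with parameter \<open>t\<close>; the parameters \<open>0\<close> and \<open>-1\<close> give \<open>v\<close> and \<open>w\<close>,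
  while \<open>u\<close> is the missing point at infinity.\<close>

definition proj_param :: "'a::field \<times> 'a \<Rightarrow> 'a \<times> 'a \<Rightarrow> 'a \<times> 'a \<Rightarrow> 'a \<Rightarrow> 'a \<times> 'a" where
  "proj_param u v w t = (vdet w u * fst v - t * vdet v w * fst u, vdet w u * snd v - t * vdet v w * snd u)"

text \<open>Multiplied by \<open>vdet v w\<close>, \<open>vdet w u\<close> and
  \<open>vdet u v\<close> in turn, these become the Pluecker terms \<open>K\<close>,
  \<open>t * K\<close> and \<open>- (1 + t) * K\<close>, where \<open>K\<close> is the product of
  those three determinants.\<close>

lemma vdet_proj_param:
  fixes u v w :: "'a::field \<times> 'a"
  shows "vdet u (proj_param u v w t) = vdet w u * vdet u v"
    and "vdet v (proj_param u v w t) = t * vdet v w * vdet u v"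
    and "vdet w (proj_param u v w t) = - (1 + t) * vdet v w * vdet w u"
  by (simp_all add: vdet_def proj_param_def algebra_simps)

context
  fixes u v w :: "'a::field \<times> 'a"
  assumes nz: "vdet u v \<noteq> 0" "vdet v w \<noteq> 0" "vdet w u \<noteq> 0"
begin

lemma reps_nonzero: "u \<noteq> (0, 0)" "v \<noteq> (0, 0)" "w \<noteq> (0, 0)"
  using nz by (auto simp: vdet_def)

lemma proj_param_nonzero: "proj_param u v w t \<noteq> (0, 0)"
  using vdet_proj_param(1)[of u v w t] nz by (auto simp: vdet_def)

text \<open>Different parameters give independent vectors, hence injectivity below.\<close>

lemma vdet_proj_param_proj_param:
  "vdet (proj_param u v w s) (proj_param u v w t) = (t - s) * (vdet v w * vdet w u * vdet u v)"
  by (simp add: vdet_def proj_param_def algebra_simps)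

lemma bij_betw_proj_param:
  "bij_betw (\<lambda>t. abs_proj_line (proj_param u v w t)) UNIV (UNIV - {abs_proj_line u})"
proof (rule bij_betw_imageI)
  show "inj (\<lambda>t. abs_proj_line (proj_param u v w t))"
    using nz by (auto intro!: injI simp: abs_proj_line_eq_iff proj_param_nonzero vdet_proj_param_proj_param)
  show "range (\<lambda>t. abs_proj_line (proj_param u v w t)) = UNIV - {abs_proj_line u}"
  proof (intro equalityI subsetI)
    fix p assume "p \<in> range (\<lambda>t. abs_proj_line (proj_param u v w t))"
    then obtain t where "p = abs_proj_line (proj_param u v w t)"
      by blast
    then have "abs_proj_line u \<noteq> p"
      using nz by (simp add: abs_proj_line_eq_iff proj_param_nonzero reps_nonzero vdet_proj_param)
    then show "p \<in> UNIV - {abs_proj_line u}"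
      by blast
  next
    fix p assume p: "p \<in> UNIV - {abs_proj_line u}"
    obtain x where x: "x \<noteq> (0, 0)" "p = abs_proj_line x"
      by (rule proj_line_rep)
    have ux: "vdet u x \<noteq> 0"
      using p x by (auto simp: abs_proj_line_eq_iff[symmetric] reps_nonzero)
    \<comment> \<open>This solves \<open>vdet (proj_param u v w t) x = 0\<close>, which is linear in
      \<open>t\<close>.\<close>
    define t where "t = vdet w u * vdet v x / (vdet v w * vdet u x)"
    have t: "t * vdet v w * vdet u x = vdet w u * vdet v x"
      using nz ux by (simp add: t_def)
    have "vdet (proj_param u v w t) x = vdet w u * vdet v x - t * vdet v w * vdet u x"
      by (simp add: vdet_def[of _ x] proj_param_def algebra_simps)
    also have "\<dots> = 0"
      using t by simp
    finally have "abs_proj_line (proj_param u v w t) = p"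
      using x by (simp add: abs_proj_line_eq_iff proj_param_nonzero)
    then show "p \<in> range (\<lambda>t. abs_proj_line (proj_param u v w t))"
      by blast
  qed
qed

text \<open>Each of the three cyclic products is the nonzero square \<open>?K\<^sup>2\<close> times
  one of the arguments on the right, and the character ignores that square.\<close>

lemma all_orders_neg_proj_param:
  "all_orders_neg (abs_proj_line u) (abs_proj_line v) (abs_proj_line w) (abs_proj_line (proj_param u v w t))
    \<longleftrightarrow> quad_char (1 + t) = - 1 \<and> quad_char (- t) = - 1 \<and> quad_char (t * (1 + t)) = - 1"
proof -
  let ?d = "proj_param u v w t" and ?K = "vdet v w * vdet w u * vdet u v"
  have K: "?K \<noteq> 0"
    using nz by simp
  have sw: "vdet ?d u = - vdet u ?d" "vdet ?d w = - vdet w ?d" "vdet u w = - vdet w u" "vdet w v = - vdet v w"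
    by (rule vdet_swap)+
  have "vdet u v * vdet v w * vdet w ?d * vdet ?d u = ?K\<^sup>2 * (1 + t)"
    "vdet u w * vdet w v * vdet v ?d * vdet ?d u = ?K\<^sup>2 * (- t)"
    "vdet u v * vdet v ?d * vdet ?d w * vdet w u = ?K\<^sup>2 * (t * (1 + t))"
    unfolding sw vdet_proj_param by (simp_all add: power2_eq_square algebra_simps)
  then show ?thesis
    unfolding all_orders_neg_def
    by (simp only: sign4_abs reps_nonzero proj_param_nonzero quad_char_mult_square[OF K] simp_thms)
qed

end

text \<open>The line is a copy of the field plus one point; the base vectors chosen have pairwise
  nonzero determinants.\<close>

lemma card_proj_line:
  shows "finite (UNIV :: 'a::{field, finite} proj_line set)"
    and "card (UNIV :: 'a proj_line set) = card (UNIV :: 'a set) + 1"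
proof -
  have "bij_betw (\<lambda>t. abs_proj_line (proj_param (1, 0) (0, 1) (1, 1) t)) (UNIV :: 'a set)
      (UNIV - {abs_proj_line (1, 0)})"
    by (rule bij_betw_proj_param) (auto simp: vdet_def)
  then have "card (UNIV :: 'a set) = card (UNIV - {abs_proj_line (1 :: 'a, 0)})"
    "finite (UNIV - {abs_proj_line (1 :: 'a, 0)})"
    using bij_betw_same_card bij_betw_finite by (blast, force)
  then show fin: "finite (UNIV :: 'a proj_line set)"
    and "card (UNIV :: 'a proj_line set) = card (UNIV :: 'a set) + 1"
    by (simp_all add: card_Diff_singleton_if)
       (metis One_nat_def Suc_pred UNIV_not_empty card_gt_0_iff finite_Diff2 finite.emptyI finite_insert)
qed

section \<open>Counting fourth points and hyperedges\<close>

lemma card_fourth_points: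
  fixes a b c :: "'a::{field, finite} proj_line"
  assumes q: "card (UNIV :: 'a set) mod 4 = 3" and dist: "distinct [a, b, c]"
  shows "4 * card {d. d \<notin> {a, b, c} \<and> all_orders_neg a b c d} = card (UNIV :: 'a set) + 1"
proof -
  obtain u where u: "u \<noteq> (0, 0)" "a = abs_proj_line u" by (rule proj_line_rep)
  obtain v where v: "v \<noteq> (0, 0)" "b = abs_proj_line v" by (rule proj_line_rep)
  obtain w where w: "w \<noteq> (0, 0)" "c = abs_proj_line w" by (rule proj_line_rep)
  have nz: "vdet u v \<noteq> 0" "vdet v w \<noteq> 0" "vdet w u \<noteq> 0"
    using dist u v w by (auto simp: abs_proj_line_eq_iff[symmetric])
  note param = bij_betw_proj_param[OF nz]
  let ?f = "\<lambda>t. abs_proj_line (proj_param u v w t)"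
  let ?T = "{t :: 'a. quad_char t = 1 \<and> quad_char (1 + t) = - 1}"
  \<comment> \<open>As -1 is a nonsquare, the condition on \<open>- t\<close> says that
    \<open>t\<close> is a nonzero square; the condition on \<open>t * (1 + t)\<close> then follows
    by multiplicativity.\<close>
  have good: "all_orders_neg a b c (?f t) \<longleftrightarrow> t \<in> ?T" for t
    unfolding u v w all_orders_neg_proj_param[OF nz]
    by (auto simp: quad_char_mult[OF q] quad_char_minus[OF q])
  \<comment> \<open>The points \<open>b\<close> and \<open>c\<close> have parameters 0 and -1, where
    \<open>t\<close> or \<open>1 + t\<close> has sign 0.\<close>
  have avoid: "?f t \<notin> {b, c}" if "t \<in> ?T" for t
  proof -
    have "t \<noteq> 0" "1 + t \<noteq> 0"
      using that by (auto simp: quad_char_def)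
    then have "vdet v (proj_param u v w t) \<noteq> 0" "vdet w (proj_param u v w t) \<noteq> 0"
      unfolding vdet_proj_param using nz by (auto simp del: minus_add_distrib)
    then have "b \<noteq> ?f t" "c \<noteq> ?f t"
      unfolding v(2) w(2) using v(1) w(1) by (simp_all add: abs_proj_line_eq_iff proj_param_nonzero[OF nz])
    then show ?thesis
      by auto
  qed
  have range: "range ?f = UNIV - {a}"
    using bij_betw_imp_surj_on[OF param] u(2) by simp
  have "{d. d \<notin> {a, b, c} \<and> all_orders_neg a b c d} = ?f ` ?T"
  proof (intro equalityI subsetI)
    fix d assume d: "d \<in> {d. d \<notin> {a, b, c} \<and> all_orders_neg a b c d}"
    then have "d \<in> range ?f"
      unfolding range by simp
    then obtain t where t: "d = ?f t"
      by (rule rangeE)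
    with d have "t \<in> ?T"
      using good[of t] by simp
    with t show "d \<in> ?f ` ?T"
      by (rule image_eqI)
  next
    fix d assume "d \<in> ?f ` ?T"
    then obtain t where t: "d = ?f t" "t \<in> ?T"
      by (rule imageE)
    have "?f t \<noteq> a"
      using rangeI[of ?f t] unfolding range by simp
    then show "d \<in> {d. d \<notin> {a, b, c} \<and> all_orders_neg a b c d}"
      unfolding t(1) using avoid[OF t(2)] good[of t] t(2) by simp
  qed
  moreover have "inj_on ?f ?T"
    using bij_betw_imp_inj_on[OF param] by (rule inj_on_subset) simp
  ultimately show ?thesis
    using card_square_succ_nonsquare[OF q] by (simp add: card_image)
qed

lemma card_hyperedge:
  assumes "e \<in> hyperedges (hypergraph_H TYPE('a::field))"
  shows "card e = 4"
  using assms by (auto simp: hypergraph_H_def)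

text \<open>Removing \<open>T\<close> from an edge leaves one point, so the edges through
  \<open>T\<close> correspond to the admissible fourth points.\<close>

lemma card_hyperedges_containing:
  fixes T :: "'a::{field, finite} proj_line set"
  assumes q: "card (UNIV :: 'a set) mod 4 = 3" and T: "card T = 3"
  shows "4 * card {e \<in> hyperedges (hypergraph_H TYPE('a)). T \<subseteq> e} = card (UNIV :: 'a set) + 1"
proof -
  obtain a b c where abc: "T = {a, b, c}" "distinct [a, b, c]"
    using T unfolding card_3_iff by auto
  let ?D = "{d. d \<notin> {a, b, c} \<and> all_orders_neg a b c d}"
  have iff: "{a, b, c, d} \<in> hyperedges (hypergraph_H TYPE('a)) \<longleftrightarrow> all_orders_neg a b c d"
    if "d \<notin> T" for d
    by (rule hyperedge_insert_iff) (use abc that in auto)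
  have "{e \<in> hyperedges (hypergraph_H TYPE('a)). T \<subseteq> e} = (\<lambda>d. {a, b, c, d}) ` ?D"
  proof (intro equalityI subsetI)
    fix e assume e: "e \<in> {e \<in> hyperedges (hypergraph_H TYPE('a)). T \<subseteq> e}"
    then have "card e = 4"
      using card_hyperedge by blast
    then have "card (e - T) = 1"
      using e T by (subst card_Diff_subset) (auto simp: abc)
    then obtain d where "e - T = {d}"
      by (auto simp: card_1_singleton_iff)
    then have "e = {a, b, c, d}" "d \<notin> T"
      using e abc(1) by auto
    then show "e \<in> (\<lambda>d. {a, b, c, d}) ` ?D"
      using e iff abc(1) by auto
  qed (use iff abc(1) in auto)
  moreover have "inj_on (\<lambda>d. {a, b, c, d}) ?D"
    by (auto simp: inj_on_def set_eq_iff)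
  ultimately show ?thesis
    using card_fourth_points[OF q abc(2)] by (simp add: card_image)
qed

lemma card_hyperedges:
  assumes q: "card (UNIV :: 'a::{field, finite} set) mod 4 = 3"
  shows "16 * card (hyperedges (hypergraph_H TYPE('a)))
    = (card (UNIV :: 'a set) + 1) * ((card (UNIV :: 'a set) + 1) choose 3)"
proof -
  let ?E = "hyperedges (hypergraph_H TYPE('a))"
  let ?T = "{T :: 'a proj_line set. T \<subseteq> UNIV \<and> card T = 3}"
  \<comment> \<open>The division is exact by the congruence \<open>q\<close>.\<close>
  let ?k = "(card (UNIV :: 'a set) + 1) div 4"
  note fin = card_proj_line(1)[where 'a = 'a]
  have finE: "finite ?E" "finite ?T"
    by (rule finite_subset[OF subset_UNIV], simp add: Finite_Set.finite_set fin)+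
  have "card {e \<in> ?E. T \<subseteq> e} = ?k" if "T \<in> ?T" for T
    using card_hyperedges_containing[OF q, of T] that by simp
  then have "(\<Sum>e\<in>?E. card {T \<in> ?T. T \<subseteq> e}) = ?k * card ?T"
    by (intro sum_multicount finE ballI)
  moreover have "card {T \<in> ?T. T \<subseteq> e} = 4" if "e \<in> ?E" for e
  proof -
    have "card e = 4" "finite e"
      using card_hyperedge[OF that] finite_subset[OF subset_UNIV fin] by auto
    \<comment> \<open>The factor 4 is the binomial coefficient \<open>4 choose 3\<close>.\<close>
    then have "card {T. T \<subseteq> e \<and> card T = 3} = 4"
      by (simp add: n_subsets numeral_eq_Suc)
    then show ?thesis
      by (simp add: conj_commute)
  qed
  ultimately have "4 * card ?E = ?k * card ?T"
    by simp
  moreover have "card ?T = (card (UNIV :: 'a set) + 1) choose 3"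
    using n_subsets[OF fin, of 3] card_proj_line(2)[where 'a = 'a] by simp
  moreover have "4 * ?k = card (UNIV :: 'a set) + 1"
    using q by presburger
  moreover have "16 * card ?E = 4 * (4 * card ?E)"
    by simp
  ultimately show ?thesis
    by (metis mult.assoc)
qed

theorem theorem2p8:
  fixes q :: nat
  assumes "primepow q" and "q mod 4 = 3" and "card (UNIV :: 'a::{field, finite} set) = q"
  shows "real (card (hyperedges (hypergraph_H TYPE('a)))) = (real q + 1) / 16 * real ((q + 1) choose 3)
    \<and> (\<forall>T. T \<subseteq> verts (hypergraph_H TYPE('a)) \<and> card T = 3 \<longrightarrow>
          real (card {e \<in> hyperedges (hypergraph_H TYPE('a)). T \<subseteq> e}) = (real q + 1) / 4)"
proof (intro conjI allI impI)
  have q: "card (UNIV :: 'a set) mod 4 = 3"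
    using assms by simp
  \<comment> \<open>The division-free identities over the naturals are cast to the reals before
    dividing.\<close>
  have "real (16 * card (hyperedges (hypergraph_H TYPE('a)))) = real ((q + 1) * ((q + 1) choose 3))"
    unfolding card_hyperedges[OF q] assms(3) ..
  then show "real (card (hyperedges (hypergraph_H TYPE('a)))) = (real q + 1) / 16 * real ((q + 1) choose 3)"
    by (simp add: algebra_simps)
  fix T :: "'a proj_line set"
  assume "T \<subseteq> verts (hypergraph_H TYPE('a)) \<and> card T = 3"
  then have "real (4 * card {e \<in> hyperedges (hypergraph_H TYPE('a)). T \<subseteq> e}) = real (q + 1)"
    using card_hyperedges_containing[OF q, of T] assms(3) by simp
  then show "real (card {e \<in> hyperedges (hypergraph_H TYPE('a)). T \<subseteq> e}) = (real q + 1) / 4"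
    by (simp add: algebra_simps)
qed

end
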